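(* For every real $\alpha>-1$, every integer $m\ge 2$, and every integer $j$ with $1\le j\le\lfloor m/2\rfloor$, $$x_{j,m-1}^{(\alpha)}\,x_{m-j,m-1}^{(\alpha)}<x_{j,m}^{(\alpha)}\,x_{m+1-j,m}^{(\alpha)}.$$ Consequently, for each $\alpha>-1$ and each fixed integer $j\ge1$, the sequence $$m\mapsto x_{j,m}^{(\alpha)}\,x_{m+1-j,m}^{(\alpha)},\qquad m\ge 2j-1,$$ is strictly increasing in $m$. Here $x_{k,m}^{(\alpha)}$ denotes the $k$th smallest zero of the generalised Laguerre polynomial $L_m^{(\alpha)}$.
   Context: For real $\alpha>-1$ and an integer $m\ge 0$, $L_m^{(\alpha)}$ is the generalised Laguerre polynomial of degree $m$ in the standard normalisation, $$L_m^{(\alpha)}(x)=\sum_{k=0}^m(-1)^k\binom{m+\alpha}{m-k}\frac{x^k}{k!}.$$ For $m\ge1$ its zeros are real, simple and positive, and they are written in increasing order as $$0<x_{1,m}^{(\alpha)}<x_{2,m}^{(\alpha)}<\cdots<x_{m,m}^{(\alpha)}.$$ *)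

theory Defs
  imports Complex_Main "HOL-Computational_Algebra.Polynomial"
begin

definition laguerre :: "real \<Rightarrow> nat \<Rightarrow> real poly" where
  "laguerre \<alpha> m =
     (\<Sum>k\<le>m. monom ((-1) ^ k * ((real m + \<alpha>) gchoose (m - k)) / fact k) k)"

(* The k-th smallest real zero, counted from 1. For \<alpha> > -1 and m \<ge> 1 the
   zeros of laguerre \<alpha> m are m distinct positive reals, so the value is
   meaningful for 1 \<le> k \<le> m; outside this range it is unspecified. *)
definition laguerre_zero :: "real \<Rightarrow> nat \<Rightarrow> nat \<Rightarrow> real" where
  "laguerre_zero \<alpha> m k = sorted_list_of_set {x. poly (laguerre \<alpha> m) x = 0} ! (k - 1)"

end

theory Submission
  imports Defs
begin

text \<open>
  Write \<open>L\<^sub>m\<close> for the Laguerre polynomial of degree \<open>m\<close>, let \<open>x < y\<close> be its \<open>j\<close>-th zeros counted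
  from the left and from the right, and let \<open>a \<le> b\<close> be the corresponding zeros of \<open>L\<^sub>m\<^sub>-\<^sub>1\<close>. By
  interlacing \<open>x < a \<le> b < y\<close>, and the claim \<open>a b < x y\<close> says that on a logarithmic scale \<open>x\<close> is
  closer to \<open>a\<close> than \<open>y\<close> is to \<open>b\<close>.

  The pair \<open>(L\<^sub>m\<^sub>-\<^sub>1, L\<^sub>m)\<close> solves a linear system of first order in the variable \<open>ln x\<close>, so the ratio
  \<open>r = L\<^sub>m\<^sub>-\<^sub>1 / L\<^sub>m\<close> solves the Riccati equation
  \<open>x r' = m - (2m + \<alpha> - x) r + (m + \<alpha>) r\<^sup>2\<close>.
  Going outwards from \<open>a\<close> to \<open>x\<close> and from \<open>b\<close> to \<open>y\<close>, the functions \<open>- r\<close> and \<open>r\<close> both grow from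
  \<open>0\<close> to \<open>\<infinity>\<close>. Their equations in the distance travelled differ only in the linear coefficient, which
  is \<open>2m + \<alpha> - X\<close> at the left position \<open>X\<close> and \<open>Y - 2m - \<alpha>\<close> at the right position \<open>Y\<close>. As long as
  \<open>X + Y < 4m + 2\<alpha>\<close>, the left ratio grows faster and therefore needs the shorter distance.

  Two points turn this into a proof. First, if \<open>x y \<le> a b\<close>, then one can travel from \<open>(a, b)\<close> to
  \<open>(x, y)\<close> along the segment between the two points in logarithmic coordinates, where \<open>X\<close> moves at
  least as fast as \<open>Y\<close>. The function \<open>L\<^sub>m\<^sub>-\<^sub>1(X) L\<^sub>m(Y) + L\<^sub>m(X) L\<^sub>m\<^sub>-\<^sub>1(Y)\<close> vanishes at both ends of the
  segment, but after multiplication by an exponential its derivative has no zero inside; this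
  contradicts Rolle's theorem (\<open>zero_product_less\<close>). Second, \<open>X + Y\<close> is convex along the segment,
  so the condition \<open>X + Y < 4m + 2\<alpha>\<close> need only be known at the ends. There it says that opposite
  zeros of a Laguerre polynomial have a small sum (\<open>laguerre_zero_sum_less\<close>): the zeros are the
  eigenvalues of a Jacobi matrix \<open>J\<close>, and if \<open>S\<close> changes the sign of every other coordinate, then
  \<open>J + S J S\<close> is diagonal with entries at most \<open>2 (2m - 1 + \<alpha>)\<close>, which by a comparison of
  eigenspaces bounds the sum of the \<open>j\<close>-th smallest and the \<open>j\<close>-th largest eigenvalue.
\<close>

section \<open>Differential and three-term recurrences\<close>

lemma coeff_laguerre:
  "coeff (laguerre \<alpha> m) k =
     (if k \<le> m then (-1) ^ k * ((real m + \<alpha>) gchoose (m - k)) / fact k else 0)"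
  by (auto simp: laguerre_def coeff_sum coeff_monom)

lemma degree_laguerre_le: "degree (laguerre \<alpha> m) \<le> m"
  by (rule degree_le) (simp add: coeff_laguerre)

lemma coeff_x_times_pderiv:
  fixes p :: "'a :: {comm_semiring_1, semiring_no_zero_divisors} poly"
  shows "coeff (pCons 0 (pderiv p)) k = of_nat k * coeff p k"
  by (cases k) (simp_all add: coeff_pCons coeff_pderiv)

text \<open>
  Together with \<open>laguerre_pderiv_upper\<close> this is the first-order system for two consecutive
  Laguerre polynomials. Comparing coefficients reduces it to the absorption identity of generalised
  binomial coefficients.
\<close>
lemma laguerre_pderiv_lower:
  "pCons 0 (pderiv (laguerre \<alpha> (Suc n))) =
     smult (real (Suc n)) (laguerre \<alpha> (Suc n)) - smult (real (Suc n) + \<alpha>) (laguerre \<alpha> n)"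
proof (rule poly_eqI)
  fix k
  have *: "(real (Suc n) - real k) * ((real (Suc n) + \<alpha>) gchoose (Suc n - k)) =
             (real (Suc n) + \<alpha>) * ((real n + \<alpha>) gchoose (n - k))" if "k \<le> n"
  proof -
    have "real (Suc (n - k)) * ((real (Suc n) + \<alpha>) gchoose Suc (n - k)) =
            (real (Suc n) + \<alpha>) * ((real (Suc n) + \<alpha> - 1) gchoose (n - k))"
      by (rule gbinomial_absorption)
    moreover have "real (Suc n) + \<alpha> - 1 = real n + \<alpha>" by simp
    moreover have "real (Suc (n - k)) = real (Suc n) - real k" "Suc n - k = Suc (n - k)"
      using that by auto
    ultimately show ?thesis by (simp only:)
  qed
  consider "k \<le> n" | "k = Suc n" | "k > Suc n" by linarith
  thus "coeff (pCons 0 (pderiv (laguerre \<alpha> (Suc n)))) k =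
          coeff (smult (real (Suc n)) (laguerre \<alpha> (Suc n)) - smult (real (Suc n) + \<alpha>) (laguerre \<alpha> n)) k"
  proof cases
    case 1
    define G H where "G = (real (Suc n) + \<alpha>) gchoose (Suc n - k)" and "H = (real n + \<alpha>) gchoose (n - k)"
    have "real k * G = real (Suc n) * G - (real (Suc n) + \<alpha>) * H"
      using *[OF 1] unfolding G_def H_def by (simp add: algebra_simps)
    moreover define D :: real where "D = (-1) ^ k / fact k"
    ultimately have *: "D * (real k * G) = D * (real (Suc n) * G - (real (Suc n) + \<alpha>) * H)"
      by (simp only:)
    have 1: "coeff (laguerre \<alpha> (Suc n)) k = D * G" "coeff (laguerre \<alpha> n) k = D * H"
      using 1 by (simp_all add: coeff_laguerre G_def H_def D_def)
    show ?thesis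
      unfolding coeff_x_times_pderiv coeff_diff coeff_smult 1 using *
      by (simp add: algebra_simps del: of_nat_Suc)
  qed (unfold coeff_x_times_pderiv coeff_diff coeff_smult, simp_all add: coeff_laguerre del: of_nat_Suc)
qed

text \<open>
  In terms of coefficients this is Pascal's rule combined with
  \<open>(r + 1) (N gchoose (r + 1)) = (N - r) (N gchoose r)\<close> for \<open>N = n + \<alpha>\<close> and \<open>r = n - k\<close>.
\<close>
lemma laguerre_pderiv_upper:
  "pCons 0 (pderiv (laguerre \<alpha> n)) =
     smult (real (Suc n)) (laguerre \<alpha> (Suc n)) - smult (real (Suc n) + \<alpha>) (laguerre \<alpha> n)
       + pCons 0 (laguerre \<alpha> n)"
proof (rule poly_eqI)
  fix k
  consider "k = 0" | "0 < k" "k \<le> n" | "k = Suc n" | "k > Suc n" by linarith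
  thus "coeff (pCons 0 (pderiv (laguerre \<alpha> n))) k = coeff (smult (real (Suc n)) (laguerre \<alpha> (Suc n))
          - smult (real (Suc n) + \<alpha>) (laguerre \<alpha> n) + pCons 0 (laguerre \<alpha> n)) k"
  proof cases
    case 1
    have "real (Suc n) * ((real (Suc n) + \<alpha>) gchoose Suc n) =
            (real (Suc n) + \<alpha>) * ((real (Suc n) + \<alpha> - 1) gchoose n)"
      by (rule gbinomial_absorption)
    thus ?thesis using 1 by (simp add: coeff_laguerre algebra_simps)
  next
    case 2
    then obtain l where l: "k = Suc l" "l < n" by (cases k) auto
    define r where "r = n - k"
    define N where "N = real n + \<alpha>"
    have eqs: "Suc n - k = Suc r" "n - l = Suc r" "n - k = r" "real r = real n - real k"
      using l by (auto simp: r_def)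
    have pas: "(real (Suc n) + \<alpha>) gchoose Suc r = (N gchoose r) + (N gchoose Suc r)"
      using gbinomial_Suc_Suc[of N r] by (simp add: N_def algebra_simps)
    have "real (Suc r) * (N gchoose Suc r) = (N - real r) * (N gchoose r)"
      using gbinomial_mult_1[of N r] by (simp add: algebra_simps)
    hence *: "real k * (N gchoose r) = real (Suc n) * ((N gchoose r) + (N gchoose Suc r))
        - (real (Suc n) + \<alpha>) * (N gchoose r) - real k * (N gchoose Suc r)"
      by (simp add: eqs N_def algebra_simps)
    define D :: real where "D = (-1) ^ l / fact k"
    have c1: "coeff (laguerre \<alpha> n) k = - D * (N gchoose r)"
      using 2 eqs(3) by (simp add: coeff_laguerre D_def N_def l(1) del: fact_Suc)
    have c2: "coeff (laguerre \<alpha> (Suc n)) k = - D * ((N gchoose r) + (N gchoose Suc r))"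
      using 2 unfolding pas[symmetric] by (simp add: coeff_laguerre eqs D_def l(1) del: fact_Suc of_nat_Suc diff_Suc_Suc)
    have c3: "coeff (pCons 0 (laguerre \<alpha> n)) k = D * (real k * (N gchoose Suc r))"
    proof -
      have "D * real k = (-1) ^ l / fact l"
        by (simp add: D_def l(1) del: of_nat_Suc)
      moreover have "coeff (pCons 0 (laguerre \<alpha> n)) k = (-1) ^ l / fact l * (N gchoose Suc r)"
        using l eqs(2) by (simp add: coeff_laguerre N_def)
      ultimately show ?thesis by (metis mult.assoc)
    qed
    show ?thesis
      unfolding coeff_x_times_pderiv coeff_diff coeff_add coeff_smult c1 c2 c3
      using arg_cong[OF *, of "\<lambda>t. - D * t"]
      by (simp add: algebra_simps del: of_nat_Suc)
  next
    case 3
    have "fact (Suc n) = real (Suc n) * fact n" by simp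
    thus ?thesis
      unfolding coeff_x_times_pderiv coeff_diff coeff_add coeff_smult 3
      by (simp add: coeff_laguerre del: of_nat_Suc fact_Suc)
  next
    case 4
    thus ?thesis
      unfolding coeff_x_times_pderiv by (cases k) (simp_all add: coeff_laguerre)
  qed
qed

lemma x_times_deriv_laguerre_lower:
  "x * poly (pderiv (laguerre \<alpha> (Suc n))) x =
     real (Suc n) * poly (laguerre \<alpha> (Suc n)) x - (real (Suc n) + \<alpha>) * poly (laguerre \<alpha> n) x"
  using arg_cong[OF laguerre_pderiv_lower[of \<alpha> n], of "\<lambda>p. poly p x"]
  by (simp only: poly_pCons poly_diff poly_smult add_0_left)

lemma x_times_deriv_laguerre_upper:
  "x * poly (pderiv (laguerre \<alpha> n)) x =
     real (Suc n) * poly (laguerre \<alpha> (Suc n)) x - (real (Suc n) + \<alpha> - x) * poly (laguerre \<alpha> n) x"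
  using arg_cong[OF laguerre_pderiv_upper[of \<alpha> n], of "\<lambda>p. poly p x"]
  by (simp only: poly_pCons poly_diff poly_smult poly_add add_0_left left_diff_distrib)

text \<open>
  The two first-order relations give two expressions for \<open>x L'\<close> with the same middle polynomial;
  equating them eliminates the derivative.
\<close>
lemma laguerre_recurrence:
  "real (Suc (Suc n)) * poly (laguerre \<alpha> (Suc (Suc n))) x =
     (2 * real (Suc n) + 1 + \<alpha> - x) * poly (laguerre \<alpha> (Suc n)) x
       - (real (Suc n) + \<alpha>) * poly (laguerre \<alpha> n) x"
proof -
  have "real (Suc (Suc n)) + \<alpha> - x = real (Suc n) + (1 + \<alpha> - x)"
       "2 * real (Suc n) + 1 + \<alpha> - x = real (Suc n) + real (Suc n) + (1 + \<alpha> - x)" by simp_all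
  thus ?thesis
    using x_times_deriv_laguerre_lower[of x \<alpha> n] x_times_deriv_laguerre_upper[of x \<alpha> "Suc n"]
    by (simp only: distrib_right)
qed

lemma poly_laguerre_0 [simp]: "poly (laguerre \<alpha> 0) x = 1"
  by (simp add: laguerre_def)

lemma poly_laguerre_1: "poly (laguerre \<alpha> (Suc 0)) x = 1 + \<alpha> - x"
  by (simp add: laguerre_def poly_monom)

lemma laguerre_pos_at_0:
  assumes "\<alpha> > -1"
  shows "poly (laguerre \<alpha> n) 0 > 0"
proof (induction n)
  case (Suc n)
  have "real (Suc n) * poly (laguerre \<alpha> (Suc n)) 0 = (real (Suc n) + \<alpha>) * poly (laguerre \<alpha> n) 0"
    using x_times_deriv_laguerre_lower[of 0 \<alpha> n] by simp
  also have "\<dots> > 0" using assms Suc by (intro mult_pos_pos) auto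
  finally show ?case by (simp only: zero_less_mult_iff) auto
qed simp

section \<open>Existence and interlacing of the zeros\<close>

text \<open>
  The factorisation carries both the location of the zeros and, through the positive constant
  \<open>1 / fact m\<close> and the factors \<open>z i - x\<close>, the sign of the polynomial between them.
\<close>
definition laguerre_zero_sequence :: "real \<Rightarrow> nat \<Rightarrow> (nat \<Rightarrow> real) \<Rightarrow> bool" where
  "laguerre_zero_sequence \<alpha> m z \<longleftrightarrow>
     strict_mono_on {1..m} z \<and> (\<forall>i\<in>{1..m}. 0 < z i) \<and>
     (\<forall>x. poly (laguerre \<alpha> m) x = (\<Prod>i=1..m. z i - x) / fact m)"

lemma laguerre_zero_sequenceI:
  assumes mono: "strict_mono_on {1..m} z" and pos: "\<And>i. i \<in> {1..m} \<Longrightarrow> 0 < z i"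
    and root: "\<And>i. i \<in> {1..m} \<Longrightarrow> poly (laguerre \<alpha> m) (z i) = 0"
  shows "laguerre_zero_sequence \<alpha> m z"
proof -
  define q where "q = smult (1 / fact m) (\<Prod>i=1..m. [:z i, -1:])"
  have deg: "degree (\<Prod>i=1..m. [:z i, -1:]) = m"
    by (subst degree_prod_sum_eq) auto
  have "lead_coeff (\<Prod>i=1..m. [:z i, -1:]) = (-1) ^ m"
    by (subst lead_coeff_prod) simp
  hence lc: "coeff (\<Prod>i=1..m. [:z i, -1:]) m = (-1) ^ m" unfolding deg .
  have inj: "inj_on z {1..m}" using mono by (rule strict_mono_on_imp_inj_on)
  have "laguerre \<alpha> m = q"
  proof (rule poly_eqI_degree_lead_coeff[where n = m and A = "z ` {1..m}"])
    show "coeff (laguerre \<alpha> m) m = coeff q m"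
      using lc by (simp add: coeff_laguerre q_def)
    show "m \<le> card (z ` {1..m})" using card_image[OF inj] by simp
    show "degree q \<le> m" using deg by (simp add: q_def)
    show "poly (laguerre \<alpha> m) x = poly q x" if "x \<in> z ` {1..m}" for x
    proof -
      have "(\<Prod>i=1..m. z i - x) = 0" using that by (intro prod_zero) auto
      moreover have "poly (laguerre \<alpha> m) x = 0" using that root by blast
      ultimately show ?thesis by (simp add: q_def poly_prod)
    qed
  qed (rule degree_laguerre_le)
  thus ?thesis
    unfolding laguerre_zero_sequence_def using mono pos by (auto simp: q_def poly_prod)
qed

lemma poly_laguerre_eq_0_iff:
  assumes "laguerre_zero_sequence \<alpha> m z"
  shows "poly (laguerre \<alpha> m) x = 0 \<longleftrightarrow> x \<in> z ` {1..m}"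
  using assms unfolding laguerre_zero_sequence_def by auto

lemma laguerre_zero_eq:
  assumes "laguerre_zero_sequence \<alpha> m z" and "i \<in> {1..m}"
  shows "laguerre_zero \<alpha> m i = z i"
proof -
  have mono: "strict_mono_on {1..m} z"
    using assms(1) by (simp add: laguerre_zero_sequence_def)
  have "{x. poly (laguerre \<alpha> m) x = 0} = set (map z [1..<Suc m])"
    using poly_laguerre_eq_0_iff[OF assms(1)] by (auto simp: atLeastLessThanSuc_atLeastAtMost)
  moreover have "sorted_wrt (<) (map z [1..<Suc m])"
    unfolding sorted_wrt_map
    by (rule sorted_wrt_mono_rel[OF _ sorted_wrt_upt]) (use mono in \<open>auto simp: strict_mono_on_def\<close>)
  ultimately have "sorted_list_of_set {x. poly (laguerre \<alpha> m) x = 0} = map z [1..<Suc m]"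
    by (simp only: sorted_list_of_set.idem_if_sorted_distinct strict_sorted_iff)
  moreover have "map z [1..<Suc m] ! (i - 1) = z i"
    using assms(2) by (subst nth_map) (auto simp del: upt_Suc)
  ultimately show ?thesis by (simp add: laguerre_zero_def del: upt_Suc)
qed

lemma sign_laguerre_between_zeros:
  assumes z: "laguerre_zero_sequence \<alpha> m z" and "k \<le> m"
    and lower: "1 \<le> k \<Longrightarrow> z k < x" and upper: "k < m \<Longrightarrow> x < z (Suc k)"
  shows "(-1) ^ k * poly (laguerre \<alpha> m) x > 0"
proof -
  have mono: "strict_mono_on {1..m} z" and fac: "poly (laguerre \<alpha> m) x = (\<Prod>i=1..m. z i - x) / fact m"
    using z by (auto simp: laguerre_zero_sequence_def)
  have le: "z i \<le> z j" if "1 \<le> i" "i \<le> j" "j \<le> m" for i j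
    using strict_mono_onD[OF mono, of i j] that by (cases "i = j") auto
  have split: "{1..m} = {1..k} \<union> {Suc k..m}" using \<open>k \<le> m\<close> by auto
  have "(\<Prod>i=1..m. z i - x) = (\<Prod>i=1..k. z i - x) * (\<Prod>i=Suc k..m. z i - x)"
    unfolding split by (rule prod.union_disjoint) auto
  moreover have "(\<Prod>i=1..k. z i - x) = (-1) ^ k * (\<Prod>i=1..k. x - z i)"
    using prod.distrib[of "\<lambda>_. -1" "\<lambda>i. x - z i" "{1..k}"] by simp
  ultimately have "(-1) ^ k * (\<Prod>i=1..m. z i - x) = (\<Prod>i=1..k. x - z i) * (\<Prod>i=Suc k..m. z i - x)"
    by simp
  also have "\<dots> > 0"
  proof (intro mult_pos_pos prod_pos)
    show "0 < x - z i" if "i \<in> {1..k}" for i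
      using that le[of i k] lower \<open>k \<le> m\<close> by auto
    show "0 < z i - x" if "i \<in> {Suc k..m}" for i
      using that le[of "Suc k" i] upper by auto
  qed
  finally show ?thesis unfolding fac by simp
qed

lemma eventually_sign_laguerre:
  "\<exists>x>B. (-1) ^ n * poly (laguerre \<alpha> n) x > 0"
proof -
  define p where "p = smult ((-1) ^ n) (laguerre \<alpha> n)"
  have "coeff p n > 0" by (simp add: p_def coeff_laguerre flip: power_add)
  moreover from this have "degree p = n"
    by (intro antisym le_degree) (auto simp: p_def degree_laguerre_le)
  ultimately have "lead_coeff p > 0" by simp
  then obtain y where y: "\<And>x. x \<ge> y \<Longrightarrow> poly p x \<ge> lead_coeff p"
    using poly_pinfty_gt_lc by blast
  have "poly p (max y (B + 1)) > 0"
    using y[of "max y (B + 1)"] \<open>lead_coeff p > 0\<close> by linarith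
  thus ?thesis by (intro exI[of _ "max y (B + 1)"]) (auto simp: p_def)
qed

text \<open>
  The sign hypothesis says that the polynomial of degree \<open>m + 1\<close> alternates in sign along
  \<open>0\<close>, the zeros of the polynomial of degree \<open>m\<close>, and a large number. The intermediate value theorem
  then yields \<open>m + 1\<close> zeros, hence all of them, and they interlace by construction.
\<close>
lemma laguerre_zeros_step:
  assumes \<alpha>: "\<alpha> > -1" and z: "laguerre_zero_sequence \<alpha> m z"
    and sgn: "\<And>i. i \<in> {1..m} \<Longrightarrow> (-1) ^ i * poly (laguerre \<alpha> (Suc m)) (z i) > 0"
  shows "\<exists>z'. laguerre_zero_sequence \<alpha> (Suc m) z' \<and> (\<forall>i\<in>{1..m}. z' i < z i \<and> z i < z' (Suc i))"
proof -
  let ?p = "laguerre \<alpha> (Suc m)"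
  obtain M where M: "M > (if m = 0 then 0 else z m)" "(-1) ^ Suc m * poly ?p M > 0"
    using eventually_sign_laguerre by blast
  \<comment> \<open>The points \<open>t 0 < \<dots> < t (m + 1)\<close> between which the sign changes.\<close>
  define t where "t i = (if i = 0 then 0 else if i \<le> m then z i else M)" for i
  have mono: "strict_mono_on {1..m} z" and pos: "\<And>i. i \<in> {1..m} \<Longrightarrow> 0 < z i"
    using z by (auto simp: laguerre_zero_sequence_def)
  have t_less: "t i < t (Suc i)" if i: "i \<le> m" for i
  proof -
    consider "i = 0" "m = 0" | "i = 0" "m > 0" | "0 < i" "i < m" | "0 < i" "i = m"
      using i by linarith
    thus ?thesis
      using M(1) pos[of 1] strict_mono_onD[OF mono, of i "Suc i"] by cases (auto simp: t_def)
  qed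
  have t_sgn: "(-1) ^ i * poly ?p (t i) > 0" if i: "i \<le> Suc m" for i
  proof -
    consider "i = 0" | "i \<in> {1..m}" | "i = Suc m" using i by force
    thus ?thesis
      using laguerre_pos_at_0[OF \<alpha>, of "Suc m"] sgn[of i] M(2) by cases (auto simp: t_def)
  qed
  have "\<exists>x. t i < x \<and> x < t (Suc i) \<and> poly ?p x = 0" if "i \<le> m" for i
  proof -
    have "0 < ((-1) ^ i * poly ?p (t i)) * ((-1) ^ Suc i * poly ?p (t (Suc i)))"
      using that by (intro mult_pos_pos[OF t_sgn t_sgn]) simp_all
    hence "poly ?p (t i) * poly ?p (t (Suc i)) < 0"
      by (cases "even i") (simp_all add: mult_ac)
    from poly_IVT[OF t_less[OF that] this] show ?thesis by blast
  qed
  then obtain r where r: "\<And>i. i \<le> m \<Longrightarrow> t i < r i \<and> r i < t (Suc i) \<and> poly ?p (r i) = 0"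
    by metis
  define z' where "z' i = r (i - 1)" for i
  have t_mono: "t i \<le> t j" if "i \<le> j" "j \<le> Suc m" for i j
    using that by (induction j rule: dec_induct) (use t_less in force)+
  have "strict_mono_on {1..Suc m} z'"
  proof (rule strict_mono_onI)
    fix i j assume ij: "i \<in> {1..Suc m}" "j \<in> {1..Suc m}" "i < j"
    have "z' i < t i" using r[of "i - 1"] ij by (auto simp: z'_def)
    also have "t i \<le> t (j - 1)" using ij by (intro t_mono) auto
    also have "\<dots> < z' j" using r[of "j - 1"] ij by (auto simp: z'_def)
    finally show "z' i < z' j" .
  qed
  moreover have "0 < z' i" if "i \<in> {1..Suc m}" for i
  proof -
    have "i - 1 \<le> m" using that by auto
    thus ?thesis using r[of "i - 1"] t_mono[of 0 "i - 1"] by (simp add: z'_def t_def[of 0])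
  qed
  moreover have "poly ?p (z' i) = 0" if "i \<in> {1..Suc m}" for i
    using r[of "i - 1"] that by (auto simp: z'_def)
  ultimately have "laguerre_zero_sequence \<alpha> (Suc m) z'"
    by (rule laguerre_zero_sequenceI)
  moreover have "z' i < z i \<and> z i < z' (Suc i)" if "i \<in> {1..m}" for i
    using r[of "i - 1"] r[of i] that by (auto simp: z'_def t_def split: if_splits)
  ultimately show ?thesis by blast
qed

text \<open>
  The sign condition reproduces itself: at a zero of degree \<open>m + 1\<close> the recurrence makes degree
  \<open>m + 2\<close> a negative multiple of degree \<open>m\<close>, whose sign is known from interlacing.
\<close>
lemma laguerre_zeros_exist:
  assumes \<alpha>: "\<alpha> > -1"
  shows "\<exists>z. laguerre_zero_sequence \<alpha> m z \<and>
           (\<forall>i\<in>{1..m}. (-1) ^ i * poly (laguerre \<alpha> (Suc m)) (z i) > 0)"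
proof (induction m)
  case 0
  show ?case by (simp add: laguerre_zero_sequence_def)
next
  case (Suc m)
  then obtain z where z: "laguerre_zero_sequence \<alpha> m z"
      "\<And>i. i \<in> {1..m} \<Longrightarrow> (-1) ^ i * poly (laguerre \<alpha> (Suc m)) (z i) > 0"
    by blast
  from laguerre_zeros_step[OF \<alpha> z] obtain z' where z': "laguerre_zero_sequence \<alpha> (Suc m) z'"
      "\<And>i. i \<in> {1..m} \<Longrightarrow> z' i < z i \<and> z i < z' (Suc i)"
    by blast
  have "(-1) ^ i * poly (laguerre \<alpha> (Suc (Suc m))) (z' i) > 0" if i: "i \<in> {1..Suc m}" for i
  proof -
    have "poly (laguerre \<alpha> (Suc m)) (z' i) = 0"
      using poly_laguerre_eq_0_iff[OF z'(1)] i by blast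
    hence "real (Suc (Suc m)) * poly (laguerre \<alpha> (Suc (Suc m))) (z' i) =
             - ((real (Suc m) + \<alpha>) * poly (laguerre \<alpha> m) (z' i))"
      using laguerre_recurrence[of m \<alpha> "z' i"] by simp
    moreover have "(-1) ^ (i - 1) * poly (laguerre \<alpha> m) (z' i) > 0"
    proof (rule sign_laguerre_between_zeros[OF z(1)])
      show "i - 1 \<le> m" using i by auto
      show "z (i - 1) < z' i" if "1 \<le> i - 1" using z'(2)[of "i - 1"] i that by auto
      show "z' i < z (Suc (i - 1))" if "i - 1 < m" using z'(2)[of i] i that by auto
    qed
    moreover have "(-1) ^ i = - ((-1) ^ (i - 1) :: real)"
      using i by (cases i) auto
    ultimately have "real (Suc (Suc m)) * ((-1) ^ i * poly (laguerre \<alpha> (Suc (Suc m))) (z' i)) =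
        (real (Suc m) + \<alpha>) * ((-1) ^ (i - 1) * poly (laguerre \<alpha> m) (z' i))"
      "(real (Suc m) + \<alpha>) * ((-1) ^ (i - 1) * poly (laguerre \<alpha> m) (z' i)) > 0"
      using \<alpha> by (simp_all add: mult.left_commute[of "real (Suc (Suc m))"] del: of_nat_Suc)
    thus ?thesis by (metis of_nat_0_less_iff zero_less_Suc zero_less_mult_pos)
  qed
  thus ?case using z'(1) by blast
qed

lemma laguerre_zero_sequence_laguerre_zero:
  assumes "\<alpha> > -1"
  shows "laguerre_zero_sequence \<alpha> m (laguerre_zero \<alpha> m)"
proof -
  obtain z where z: "laguerre_zero_sequence \<alpha> m z"
    using laguerre_zeros_exist[OF assms] by blast
  show ?thesis
    using z laguerre_zero_eq[OF z] by (auto simp: laguerre_zero_sequence_def strict_mono_on_def)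
qed

lemma laguerre_zeros_interlace:
  assumes \<alpha>: "\<alpha> > -1" and i: "i \<in> {1..m}"
  shows "laguerre_zero \<alpha> (Suc m) i < laguerre_zero \<alpha> m i"
    and "laguerre_zero \<alpha> m i < laguerre_zero \<alpha> (Suc m) (Suc i)"
proof -
  obtain z where z: "laguerre_zero_sequence \<alpha> m z"
      "\<And>i. i \<in> {1..m} \<Longrightarrow> (-1) ^ i * poly (laguerre \<alpha> (Suc m)) (z i) > 0"
    using laguerre_zeros_exist[OF \<alpha>] by blast
  from laguerre_zeros_step[OF \<alpha> z] obtain z' where z': "laguerre_zero_sequence \<alpha> (Suc m) z'"
      "\<forall>i\<in>{1..m}. z' i < z i \<and> z i < z' (Suc i)"
    by blast
  show "laguerre_zero \<alpha> (Suc m) i < laguerre_zero \<alpha> m i"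
       "laguerre_zero \<alpha> m i < laguerre_zero \<alpha> (Suc m) (Suc i)"
    using z'(2) i by (auto simp: laguerre_zero_eq[OF z(1)] laguerre_zero_eq[OF z'(1)])
qed

section \<open>Sums of opposite zeros via the Jacobi matrix\<close>

text \<open>
  Gaussian elimination: an equation that is not identically zero determines one unknown, and
  substituting it leaves one equation and one unknown fewer.
\<close>
lemma homogeneous_system_nontrivial_solution:
  fixes g :: "'i \<Rightarrow> nat \<Rightarrow> real"
  assumes "finite I" "n < card I"
  shows "\<exists>c. (\<exists>i\<in>I. c i \<noteq> 0) \<and> (\<forall>k<n. (\<Sum>i\<in>I. c i * g i k) = 0)"
  using assms
proof (induction n arbitrary: I g)
  case 0
  then obtain i where "i \<in> I" by fastforce
  thus ?case by (intro exI[of _ "\<lambda>_. 1"]) auto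
next
  case (Suc n)
  show ?case
  proof (cases "\<forall>i\<in>I. g i n = 0")
    case True
    obtain c where c: "\<exists>i\<in>I. c i \<noteq> 0" "\<forall>k<n. (\<Sum>i\<in>I. c i * g i k) = 0"
      using Suc.IH[of I g] Suc.prems by auto
    have "(\<Sum>i\<in>I. c i * g i k) = 0" if "k < Suc n" for k
      using that c(2) True by (cases "k = n") auto
    thus ?thesis using c(1) by blast
  next
    case False
    then obtain p where p: "p \<in> I" "g p n \<noteq> 0" by blast
    define J where "J = I - {p}"
    have J: "finite J" "p \<notin> J" "I = insert p J" "n < card J"
      using Suc.prems p(1) by (auto simp: J_def)
    obtain c where c: "\<exists>i\<in>J. c i \<noteq> 0" "\<And>k. k < n \<Longrightarrow> (\<Sum>i\<in>J. c i * (g i k - g i n / g p n * g p k)) = 0"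
      using Suc.IH[of J "\<lambda>i k. g i k - g i n / g p n * g p k"] J by auto
    \<comment> \<open>The value of the unknown \<open>p\<close> that solves the last equation.\<close>
    define d where "d = c(p := - (\<Sum>i\<in>J. c i * g i n) / g p n)"
    have dJ: "(\<Sum>i\<in>J. d i * g i k) = (\<Sum>i\<in>J. c i * g i k)" for k
      using J(2) by (intro sum.cong) (auto simp: d_def)
    have "(\<Sum>i\<in>I. d i * g i k) = (\<Sum>i\<in>J. c i * (g i k - g i n / g p n * g p k))" for k
    proof -
      have "(\<Sum>i\<in>I. d i * g i k) = d p * g p k + (\<Sum>i\<in>J. c i * g i k)"
        using J(1,2) by (simp add: J(3) dJ)
      also have "d p * g p k = - (\<Sum>i\<in>J. c i * (g i n / g p n * g p k))"
        by (simp add: d_def sum_distrib_left sum_divide_distrib mult_ac)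
      finally show ?thesis by (simp add: right_diff_distrib sum_subtractf)
    qed
    moreover have "(\<Sum>i\<in>J. c i * (g i n - g i n / g p n * g p n)) = 0"
      using p(2) by simp
    ultimately have "\<forall>k<Suc n. (\<Sum>i\<in>I. d i * g i k) = 0"
      using c(2) by (auto simp: less_Suc_eq)
    moreover have "\<exists>i\<in>I. d i \<noteq> 0" using c(1) J(2,3) by (auto simp: d_def)
    ultimately show ?thesis by blast
  qed
qed

text \<open>
  The reciprocals of the squared norms of the Laguerre polynomials for the gamma distribution.
  With respect to these weights the tridiagonal operator of the three-term recurrence is symmetric.
\<close>
definition laguerre_weight :: "real \<Rightarrow> nat \<Rightarrow> real" where
  "laguerre_weight \<alpha> k = fact k / pochhammer (\<alpha> + 1) k"

definition laguerre_inner :: "real \<Rightarrow> nat \<Rightarrow> (nat \<Rightarrow> real) \<Rightarrow> (nat \<Rightarrow> real) \<Rightarrow> real" where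
  "laguerre_inner \<alpha> n f g = (\<Sum>k\<le>n. laguerre_weight \<alpha> k * f k * g k)"

text \<open>
  The symmetric bilinear form of the Jacobi matrix of order \<open>n + 1\<close>, whose eigenvalues are the
  zeros of the polynomial of degree \<open>n + 1\<close>.
\<close>
definition laguerre_jacobi_form :: "real \<Rightarrow> nat \<Rightarrow> (nat \<Rightarrow> real) \<Rightarrow> (nat \<Rightarrow> real) \<Rightarrow> real" where
  "laguerre_jacobi_form \<alpha> n f g =
     (\<Sum>k\<le>n. laguerre_weight \<alpha> k * (2 * real k + 1 + \<alpha>) * f k * g k)
     - (\<Sum>k<n. laguerre_weight \<alpha> k * real (Suc k) * (f k * g (Suc k) + f (Suc k) * g k))"

abbreviation laguerre_values :: "real \<Rightarrow> real \<Rightarrow> nat \<Rightarrow> real" where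
  "laguerre_values \<alpha> x \<equiv> \<lambda>k. poly (laguerre \<alpha> k) x"

lemma laguerre_weight_pos: "\<alpha> > -1 \<Longrightarrow> laguerre_weight \<alpha> k > 0"
  unfolding laguerre_weight_def by (intro divide_pos_pos pochhammer_pos) auto

lemma laguerre_weight_Suc:
  assumes "\<alpha> > -1"
  shows "laguerre_weight \<alpha> (Suc k) * (real (Suc k) + \<alpha>) = laguerre_weight \<alpha> k * real (Suc k)"
proof -
  have "real (Suc k) + \<alpha> \<noteq> 0" using assms by simp
  moreover have "pochhammer (\<alpha> + 1) (Suc k) = pochhammer (\<alpha> + 1) k * (real (Suc k) + \<alpha>)"
    by (simp add: pochhammer_Suc algebra_simps)
  ultimately show ?thesis by (simp add: laguerre_weight_def mult.commute del: of_nat_Suc)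
qed

lemma laguerre_inner_commute: "laguerre_inner \<alpha> n f g = laguerre_inner \<alpha> n g f"
  by (simp add: laguerre_inner_def mult_ac)

lemma laguerre_jacobi_form_commute: "laguerre_jacobi_form \<alpha> n f g = laguerre_jacobi_form \<alpha> n g f"
  by (simp add: laguerre_jacobi_form_def mult_ac add.commute)

lemma laguerre_inner_sum:
  "laguerre_inner \<alpha> n (\<lambda>k. \<Sum>x\<in>R. a x * f x k) g = (\<Sum>x\<in>R. a x * laguerre_inner \<alpha> n (f x) g)"
  unfolding laguerre_inner_def sum_distrib_left sum_distrib_right
  by (subst sum.swap) (simp add: mult_ac)

lemma laguerre_jacobi_form_sum:
  "laguerre_jacobi_form \<alpha> n (\<lambda>k. \<Sum>x\<in>R. a x * f x k) g =
     (\<Sum>x\<in>R. a x * laguerre_jacobi_form \<alpha> n (f x) g)"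
proof -
  have "(\<Sum>k\<le>n. laguerre_weight \<alpha> k * (2 * real k + 1 + \<alpha>) * (\<Sum>x\<in>R. a x * f x k) * g k) =
        (\<Sum>x\<in>R. a x * (\<Sum>k\<le>n. laguerre_weight \<alpha> k * (2 * real k + 1 + \<alpha>) * f x k * g k))"
    unfolding sum_distrib_left sum_distrib_right by (subst sum.swap) (simp add: mult_ac)
  moreover have "(\<Sum>k<n. laguerre_weight \<alpha> k * real (Suc k) *
          ((\<Sum>x\<in>R. a x * f x k) * g (Suc k) + (\<Sum>x\<in>R. a x * f x (Suc k)) * g k)) =
        (\<Sum>x\<in>R. a x * (\<Sum>k<n. laguerre_weight \<alpha> k * real (Suc k) *
          (f x k * g (Suc k) + f x (Suc k) * g k)))"
    unfolding sum_distrib_left sum_distrib_right sum.distrib[symmetric]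
    by (subst sum.swap) (simp add: distrib_left mult_ac del: of_nat_Suc)
  ultimately show ?thesis
    by (simp only: laguerre_jacobi_form_def right_diff_distrib sum_subtractf)
qed

text \<open>
  The recurrence states that the vector of values \<open>L\<^sub>k(x)\<close>, \<open>k \<le> n\<close>, is an eigenvector of the Jacobi
  matrix for \<open>x\<close>, up to an error in the last coordinate that is proportional to \<open>L\<^sub>n\<^sub>+\<^sub>1(x)\<close> and so
  disappears at the zeros.
\<close>
lemma laguerre_jacobi_form_laguerre_values:
  assumes "\<alpha> > -1"
  shows "laguerre_jacobi_form \<alpha> n (laguerre_values \<alpha> x) g =
           x * laguerre_inner \<alpha> n (laguerre_values \<alpha> x) g
           + laguerre_weight \<alpha> n * real (Suc n) * poly (laguerre \<alpha> (Suc n)) x * g n"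
proof (induction n)
  case 0
  show ?case
    by (simp add: laguerre_jacobi_form_def laguerre_inner_def laguerre_weight_def poly_laguerre_1 algebra_simps)
next
  case (Suc n)
  let ?e = "laguerre_values \<alpha> x" and ?w = "laguerre_weight \<alpha>"
  have "laguerre_jacobi_form \<alpha> (Suc n) ?e g = laguerre_jacobi_form \<alpha> n ?e g
      + ?w (Suc n) * (2 * real (Suc n) + 1 + \<alpha>) * ?e (Suc n) * g (Suc n)
      - ?w n * real (Suc n) * (?e n * g (Suc n) + ?e (Suc n) * g n)"
    by (simp add: laguerre_jacobi_form_def del: of_nat_Suc)
  also have "\<dots> = x * laguerre_inner \<alpha> n ?e g
      + ?w (Suc n) * (2 * real (Suc n) + 1 + \<alpha>) * ?e (Suc n) * g (Suc n)
      - (?w n * real (Suc n)) * ?e n * g (Suc n)"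
    by (simp add: Suc.IH algebra_simps del: of_nat_Suc)
  also have "\<dots> = x * laguerre_inner \<alpha> n ?e g
      + ?w (Suc n) * g (Suc n) * ((2 * real (Suc n) + 1 + \<alpha>) * ?e (Suc n) - (real (Suc n) + \<alpha>) * ?e n)"
    unfolding laguerre_weight_Suc[OF assms, symmetric] by (simp add: algebra_simps del: of_nat_Suc)
  also have "(2 * real (Suc n) + 1 + \<alpha>) * ?e (Suc n) - (real (Suc n) + \<alpha>) * ?e n =
               x * ?e (Suc n) + real (Suc (Suc n)) * ?e (Suc (Suc n))"
    unfolding laguerre_recurrence by (simp add: left_diff_distrib)
  finally show ?case
    by (simp add: laguerre_inner_def algebra_simps del: of_nat_Suc)
qed

text \<open>
  Eigenvectors of a symmetric form for different eigenvalues.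
\<close>
lemma laguerre_values_orthogonal:
  assumes "\<alpha> > -1" and "poly (laguerre \<alpha> (Suc n)) x = 0" "poly (laguerre \<alpha> (Suc n)) y = 0" and "x \<noteq> y"
  shows "laguerre_inner \<alpha> n (laguerre_values \<alpha> x) (laguerre_values \<alpha> y) = 0"
proof -
  have "x * laguerre_inner \<alpha> n (laguerre_values \<alpha> x) (laguerre_values \<alpha> y) =
        y * laguerre_inner \<alpha> n (laguerre_values \<alpha> x) (laguerre_values \<alpha> y)"
    using laguerre_jacobi_form_laguerre_values[OF assms(1), of n x "laguerre_values \<alpha> y"]
          laguerre_jacobi_form_laguerre_values[OF assms(1), of n y "laguerre_values \<alpha> x"] assms(2,3)
    by (simp only: laguerre_jacobi_form_commute[of \<alpha> n "laguerre_values \<alpha> x" "laguerre_values \<alpha> y"]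
        laguerre_inner_commute[of \<alpha> n "laguerre_values \<alpha> x" "laguerre_values \<alpha> y"])
  thus ?thesis using assms(4) by simp
qed

lemma laguerre_values_norm_pos:
  assumes "\<alpha> > -1"
  shows "laguerre_inner \<alpha> n (laguerre_values \<alpha> x) (laguerre_values \<alpha> x) > 0"
  unfolding laguerre_inner_def mult.assoc
proof (rule sum_pos2[of _ 0])
  show "laguerre_weight \<alpha> k * (laguerre_values \<alpha> x k * laguerre_values \<alpha> x k) \<ge> 0" for k
    using laguerre_weight_pos[OF assms, of k] by simp
qed (use laguerre_weight_pos[OF assms, of 0] in auto)

text \<open>
  In an orthogonal basis of eigenvectors the form is diagonal, so on the span of eigenvectors with
  eigenvalues at least \<open>c\<close> it is at least \<open>c\<close> times the inner product. The second claim is the linear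
  independence of the eigenvectors, in the form in which it is used.
\<close>
lemma laguerre_jacobi_form_lower_bound:
  fixes a :: "real \<Rightarrow> real"
  assumes \<alpha>: "\<alpha> > -1" and R: "finite R" "\<And>x. x \<in> R \<Longrightarrow> poly (laguerre \<alpha> (Suc n)) x = 0"
    and c: "\<And>x. x \<in> R \<Longrightarrow> c \<le> x"
  defines "v \<equiv> \<lambda>k. \<Sum>x\<in>R. a x * laguerre_values \<alpha> x k"
  shows "laguerre_jacobi_form \<alpha> n v v \<ge> c * laguerre_inner \<alpha> n v v"
    and "(\<exists>x\<in>R. a x \<noteq> 0) \<Longrightarrow> laguerre_inner \<alpha> n v v > 0"
proof -
  define N where "N x = laguerre_inner \<alpha> n (laguerre_values \<alpha> x) (laguerre_values \<alpha> x)" for x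
  have N: "N x > 0" for x unfolding N_def by (rule laguerre_values_norm_pos[OF \<alpha>])
  have comp: "laguerre_inner \<alpha> n (laguerre_values \<alpha> x) v = a x * N x" if "x \<in> R" for x
  proof -
    have "laguerre_inner \<alpha> n (laguerre_values \<alpha> x) v =
            (\<Sum>y\<in>R. a y * laguerre_inner \<alpha> n (laguerre_values \<alpha> y) (laguerre_values \<alpha> x))"
      unfolding v_def laguerre_inner_commute[of \<alpha> n "laguerre_values \<alpha> x"] by (rule laguerre_inner_sum)
    also have "\<dots> = (\<Sum>y\<in>R. if y = x then a x * N x else 0)"
      using laguerre_values_orthogonal[OF \<alpha>] R(2) that by (intro sum.cong) (auto simp: N_def)
    finally show ?thesis using R(1) that by simp
  qed
  have inner: "laguerre_inner \<alpha> n v v = (\<Sum>x\<in>R. (a x)\<^sup>2 * N x)"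
  proof -
    have "laguerre_inner \<alpha> n v v = (\<Sum>x\<in>R. a x * laguerre_inner \<alpha> n (laguerre_values \<alpha> x) v)"
      by (subst (1) v_def) (rule laguerre_inner_sum)
    thus ?thesis using comp by (simp add: power2_eq_square mult_ac)
  qed
  have "laguerre_jacobi_form \<alpha> n v v = (\<Sum>x\<in>R. a x * laguerre_jacobi_form \<alpha> n (laguerre_values \<alpha> x) v)"
    by (subst (1) v_def) (rule laguerre_jacobi_form_sum)
  also have "\<dots> = (\<Sum>x\<in>R. x * ((a x)\<^sup>2 * N x))"
    using comp R(2) laguerre_jacobi_form_laguerre_values[OF \<alpha>, of n _ v]
    by (intro sum.cong) (simp_all add: power2_eq_square mult_ac)
  also have "\<dots> \<ge> (\<Sum>x\<in>R. c * ((a x)\<^sup>2 * N x))"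
    using c less_imp_le[OF N] by (intro sum_mono mult_right_mono) auto
  finally show "laguerre_jacobi_form \<alpha> n v v \<ge> c * laguerre_inner \<alpha> n v v"
    by (simp add: inner sum_distrib_left)
  show "laguerre_inner \<alpha> n v v > 0" if "\<exists>x\<in>R. a x \<noteq> 0"
  proof -
    from that obtain x where "x \<in> R" "a x \<noteq> 0" by blast
    thus ?thesis unfolding inner using N R(1)
      by (intro sum_pos2[of _ x]) (auto intro!: mult_nonneg_nonneg intro: less_imp_le)
  qed
qed

text \<open>
  By counting dimensions, the span of the eigenvectors for \<open>R\<close> and the span of those for \<open>S\<close>, the
  latter with alternating signs put in, share a nonzero vector \<open>v\<close>. Adding the lower bounds of the
  form at \<open>v\<close> and at its alternating version \<open>u\<close> cancels the off-diagonal part, and what remains is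
  bounded by the largest diagonal entry.
\<close>
lemma sum_of_zero_bounds_le:
  assumes \<alpha>: "\<alpha> > -1" and R: "finite R" "\<And>x. x \<in> R \<Longrightarrow> poly (laguerre \<alpha> (Suc n)) x = 0 \<and> s \<le> x"
    and S: "finite S" "\<And>x. x \<in> S \<Longrightarrow> poly (laguerre \<alpha> (Suc n)) x = 0 \<and> t \<le> x"
    and card: "Suc n < card R + card S"
  shows "s + t \<le> 2 * (2 * real n + 1 + \<alpha>)"
proof -
  \<comment> \<open>A vanishing combination of these vectors yields a common element of the two spans.\<close>
  define g where "g i k = (case i of Inl x \<Rightarrow> laguerre_values \<alpha> x k
                                    | Inr x \<Rightarrow> - ((-1) ^ k) * laguerre_values \<alpha> x k)" for i k
  have "finite (R <+> S)" "Suc n < card (R <+> S)"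
    using R(1) S(1) card by (simp_all add: card_Plus)
  from homogeneous_system_nontrivial_solution[OF this, of g] obtain c
    where c: "\<exists>i\<in>R <+> S. c i \<noteq> 0" "\<And>k. k \<le> n \<Longrightarrow> (\<Sum>i\<in>R <+> S. c i * g i k) = 0"
    by (auto simp: less_Suc_eq_le)
  define v where "v k = (\<Sum>x\<in>R. c (Inl x) * laguerre_values \<alpha> x k)" for k
  define u where "u k = (\<Sum>x\<in>S. c (Inr x) * laguerre_values \<alpha> x k)" for k
  have uv: "v k = (-1) ^ k * u k" if "k \<le> n" for k
  proof -
    have "0 = (\<Sum>x\<in>R. c (Inl x) * g (Inl x) k) + (\<Sum>x\<in>S. c (Inr x) * g (Inr x) k)"
      using c(2)[OF that] R(1) S(1) by (simp add: sum.Plus)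
    also have "\<dots> = v k - (-1) ^ k * u k"
      by (simp add: g_def v_def u_def sum_distrib_left sum_negf mult_ac)
    finally show ?thesis by simp
  qed
  have sq: "v k * v k = u k * u k" if "k \<le> n" for k
    using uv[OF that] by (cases "even k") auto
  have cross: "v k * v (Suc k) = - (u k * u (Suc k))" if "k < n" for k
    using uv[of k] uv[of "Suc k"] that by (cases "even k") auto
  have inner_eq: "laguerre_inner \<alpha> n v v = laguerre_inner \<alpha> n u u"
    unfolding laguerre_inner_def mult.assoc by (intro sum.cong refl) (simp add: sq)
  have "laguerre_inner \<alpha> n v v > 0"
  proof -
    from c(1) consider x where "x \<in> R" "c (Inl x) \<noteq> 0" | x where "x \<in> S" "c (Inr x) \<noteq> 0"
      by auto
    thus ?thesis
    proof cases
      case 1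
      thus ?thesis unfolding v_def[abs_def]
        by (intro laguerre_jacobi_form_lower_bound(2)[OF \<alpha> R(1), where c = s]) (use R(2) in auto)
    next
      case 2
      thus ?thesis unfolding inner_eq unfolding u_def[abs_def]
        by (intro laguerre_jacobi_form_lower_bound(2)[OF \<alpha> S(1), where c = t]) (use S(2) in auto)
    qed
  qed
  moreover have "(s + t) * laguerre_inner \<alpha> n v v \<le> 2 * (2 * real n + 1 + \<alpha>) * laguerre_inner \<alpha> n v v"
  proof -
    have "s * laguerre_inner \<alpha> n v v \<le> laguerre_jacobi_form \<alpha> n v v"
      unfolding v_def[abs_def] by (rule laguerre_jacobi_form_lower_bound(1)[OF \<alpha> R(1)]) (use R(2) in auto)
    moreover have "t * laguerre_inner \<alpha> n u u \<le> laguerre_jacobi_form \<alpha> n u u"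
      unfolding u_def[abs_def] by (rule laguerre_jacobi_form_lower_bound(1)[OF \<alpha> S(1)]) (use S(2) in auto)
    ultimately have "(s + t) * laguerre_inner \<alpha> n v v \<le> laguerre_jacobi_form \<alpha> n v v + laguerre_jacobi_form \<alpha> n u u"
      by (simp add: inner_eq distrib_right)
    also have "\<dots> = 2 * (\<Sum>k\<le>n. (2 * real k + 1 + \<alpha>) * (laguerre_weight \<alpha> k * (v k * v k)))"
    proof -
      have "(\<Sum>k\<le>n. laguerre_weight \<alpha> k * (2 * real k + 1 + \<alpha>) * u k * u k) =
            (\<Sum>k\<le>n. laguerre_weight \<alpha> k * (2 * real k + 1 + \<alpha>) * v k * v k)"
        by (intro sum.cong refl) (simp add: sq mult.assoc)
      moreover have "(\<Sum>k<n. laguerre_weight \<alpha> k * real (Suc k) * (v k * v (Suc k) + v (Suc k) * v k)) =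
                 - (\<Sum>k<n. laguerre_weight \<alpha> k * real (Suc k) * (u k * u (Suc k) + u (Suc k) * u k))"
        unfolding sum_negf[symmetric]
      proof (intro sum.cong refl)
        fix k assume "k \<in> {..<n}"
        hence "v k * v (Suc k) = - (u k * u (Suc k))" by (simp add: cross)
        moreover from this have "v (Suc k) * v k = - (u (Suc k) * u k)" by (simp add: mult.commute)
        ultimately show "laguerre_weight \<alpha> k * real (Suc k) * (v k * v (Suc k) + v (Suc k) * v k) =
            - (laguerre_weight \<alpha> k * real (Suc k) * (u k * u (Suc k) + u (Suc k) * u k))"
          by (simp del: of_nat_Suc)
      qed
      ultimately show ?thesis
        by (simp add: laguerre_jacobi_form_def mult_ac)
    qed
    also have "\<dots> \<le> 2 * (\<Sum>k\<le>n. (2 * real n + 1 + \<alpha>) * (laguerre_weight \<alpha> k * (v k * v k)))"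
      using less_imp_le[OF laguerre_weight_pos[OF \<alpha>]]
      by (intro mult_left_mono sum_mono mult_right_mono) auto
    also have "\<dots> = 2 * (2 * real n + 1 + \<alpha>) * laguerre_inner \<alpha> n v v"
      by (simp only: laguerre_inner_def sum_distrib_left[symmetric] mult.assoc)
    finally show ?thesis .
  qed
  ultimately show ?thesis by (simp only: mult_le_cancel_right_pos)
qed

text \<open>
  Apply the preceding bound to the zeros from index \<open>j\<close> on and to those from index \<open>m + 1 - j\<close>
  on: together these are \<open>m + 1\<close> vectors in dimension \<open>m\<close>.
\<close>
lemma laguerre_zero_sum_less:
  assumes \<alpha>: "\<alpha> > -1" and j: "1 \<le> j" "j \<le> m"
  shows "laguerre_zero \<alpha> m j + laguerre_zero \<alpha> m (m + 1 - j) < 4 * real m + 2 * \<alpha>"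
proof -
  from j obtain n where m: "m = Suc n" by (cases m) auto
  let ?z = "laguerre_zero \<alpha> m"
  have z: "laguerre_zero_sequence \<alpha> m ?z"
    by (rule laguerre_zero_sequence_laguerre_zero[OF \<alpha>])
  hence mono: "strict_mono_on {1..m} ?z" by (simp add: laguerre_zero_sequence_def)
  have card: "card (?z ` {i..m}) = Suc m - i" if "1 \<le> i" for i
    using inj_on_subset[OF strict_mono_on_imp_inj_on[OF mono], of "{i..m}"] that
    by (simp add: card_image)
  have bound: "poly (laguerre \<alpha> (Suc n)) x = 0 \<and> ?z i \<le> x" if "x \<in> ?z ` {i..m}" "1 \<le> i" for i x
  proof -
    from that(1) obtain l where "l \<in> {i..m}" "x = ?z l" by blast
    thus ?thesis
      using poly_laguerre_eq_0_iff[OF z, of x] strict_mono_on_leD[OF mono, of i l] that(2)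
      by (auto simp: m)
  qed
  have "?z j + ?z (m + 1 - j) \<le> 2 * (2 * real n + 1 + \<alpha>)"
    by (rule sum_of_zero_bounds_le[OF \<alpha>, of "?z ` {j..m}" _ _ "?z ` {m + 1 - j..m}"])
       (use bound[of _ j] bound[of _ "m + 1 - j"] card j in \<open>auto simp: m\<close>)
  thus ?thesis by (simp add: m)
qed

section \<open>Comparison of the two ends of the spectrum\<close>

text \<open>
  Convexity of \<open>exp\<close>, from the tangent line at \<open>c t\<close>; it will bound the sum of two positions
  moving exponentially in terms of its values at the two ends of the motion.
\<close>
lemma exp_le_chord:
  fixes c t T :: real
  assumes "0 \<le> t" "t \<le> T"
  shows "T * exp (c * t) \<le> (T - t) + t * exp (c * T)"
proof -
  have 1: "1 - c * t \<le> exp (- (c * t))"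
    using exp_ge_add_one_self[of "- (c * t)"] by simp
  have 2: "1 + c * (T - t) \<le> exp (c * T - c * t)"
    using exp_ge_add_one_self[of "c * (T - t)"] by (simp add: algebra_simps)
  have "T = (T - t) * (1 - c * t) + t * (1 + c * (T - t))" by algebra
  also have "\<dots> \<le> (T - t) * exp (- (c * t)) + t * exp (c * T - c * t)"
    using assms 1 2 by (intro add_mono mult_left_mono) auto
  finally have "T * exp (c * t) \<le> ((T - t) * exp (- (c * t)) + t * exp (c * T - c * t)) * exp (c * t)"
    by (intro mult_right_mono) auto
  also have "\<dots> = (T - t) + t * exp (c * T)"
    by (simp add: distrib_right mult.assoc flip: exp_add)
  finally show ?thesis .
qed

text \<open>
  The first-order system along a point moving with logarithmic velocity \<open>s\<close>.
\<close>
lemma DERIV_laguerre_pair_along: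
  fixes X :: "real \<Rightarrow> real"
  assumes "(X has_real_derivative s * X t) (at t)"
  shows "((\<lambda>t. poly (laguerre \<alpha> (Suc n)) (X t)) has_real_derivative
            s * (real (Suc n) * poly (laguerre \<alpha> (Suc n)) (X t)
                 - (real (Suc n) + \<alpha>) * poly (laguerre \<alpha> n) (X t))) (at t)"
    and "((\<lambda>t. poly (laguerre \<alpha> n) (X t)) has_real_derivative
            s * (real (Suc n) * poly (laguerre \<alpha> (Suc n)) (X t)
                 - (real (Suc n) + \<alpha> - X t) * poly (laguerre \<alpha> n) (X t))) (at t)"
  unfolding x_times_deriv_laguerre_lower[symmetric] x_times_deriv_laguerre_upper[symmetric]
  by (rule DERIV_cong[OF DERIV_chain2[OF poly_DERIV assms]]; simp)+

text \<open>
  The comparison argument. The logarithmic velocities of \<open>X\<close> and \<open>Y\<close> are \<open>- l\<close> and \<open>1\<close>, and the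
  contrary assumption \<open>x y \<le> a b\<close> is exactly \<open>l \<ge> 1\<close>. Besides the linear coefficients, the velocity
  excess \<open>l - 1\<close> also acts in favour of the left ratio, so all terms of the derivative have the same
  sign.
\<close>
lemma zero_product_less:
  assumes \<alpha>: "\<alpha> > -1"
    and order: "0 < x" "x < a" "a \<le> b" "b < y"
    and zeros: "poly (laguerre \<alpha> n) a = 0" "poly (laguerre \<alpha> n) b = 0"
      "poly (laguerre \<alpha> (Suc n)) x = 0" "poly (laguerre \<alpha> (Suc n)) y = 0"
    and neg: "\<And>u. x < u \<Longrightarrow> u < a \<Longrightarrow> poly (laguerre \<alpha> n) u * poly (laguerre \<alpha> (Suc n)) u < 0"
    and pos: "\<And>u. b < u \<Longrightarrow> u < y \<Longrightarrow> poly (laguerre \<alpha> n) u * poly (laguerre \<alpha> (Suc n)) u > 0"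
    and sums: "a + b < 4 * real (Suc n) + 2 * \<alpha>" "x + y < 4 * real (Suc n) + 2 * \<alpha>"
  shows "a * b < x * y"
proof (rule ccontr)
  assume "\<not> a * b < x * y"
  hence "y / b \<le> a / x" using order by (simp add: field_simps)
  define M where "M = real (Suc n)"
  define T where "T = ln (y / b)"
  define l where "l = ln (a / x) / T"
  have T: "T > 0" unfolding T_def using order by simp
  have "T \<le> ln (a / x)"
    unfolding T_def using order \<open>y / b \<le> a / x\<close> by simp
  hence l: "l \<ge> 1" "l * T = ln (a / x)" using T by (auto simp: l_def)
  define X where "X t = a * exp (- l * t)" for t
  define Y where "Y t = b * exp t" for t
  have X0: "X 0 = a" and Y0: "Y 0 = b" by (simp_all add: X_def Y_def)
  have XT: "X T = x" using order by (simp add: X_def l(2) exp_minus)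
  have YT: "Y T = y" using order by (simp add: Y_def T_def)
  define A where "A t = poly (laguerre \<alpha> n) (X t)" for t
  define C where "C t = poly (laguerre \<alpha> (Suc n)) (X t)" for t
  define A' where "A' t = poly (laguerre \<alpha> n) (Y t)" for t
  define C' where "C' t = poly (laguerre \<alpha> (Suc n)) (Y t)" for t
  define E where "E t = A t * C' t + C t * A' t" for t
  \<comment> \<open>The integrating factor that removes the multiple of \<open>E\<close> from the derivative of \<open>E\<close> and leaves \<open>S\<close>.\<close>
  define \<mu> where "\<mu> t = exp ((l * M + M + \<alpha>) * t - b * exp t)" for t
  define S where "S t = (l - 1) * ((M + \<alpha>) * (A t * A' t) - M * (C t * C' t))
                          + A t * C' t * (l * (2 * M + \<alpha> - X t) + (2 * M + \<alpha> - Y t))" for t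
  have dX: "(X has_real_derivative - l * X t) (at t)" for t
    unfolding X_def by (auto intro!: derivative_eq_intros)
  have dY: "(Y has_real_derivative 1 * Y t) (at t)" for t
    unfolding Y_def by (auto intro!: derivative_eq_intros)
  have deriv: "((\<lambda>t. \<mu> t * E t) has_real_derivative \<mu> t * S t) (at t)" for t
  proof -
    note d = DERIV_laguerre_pair_along[OF dX[of t], of \<alpha> n, folded A_def C_def M_def]
             DERIV_laguerre_pair_along[OF dY[of t], of \<alpha> n, folded A'_def C'_def M_def]
    have d\<mu>: "(\<mu> has_real_derivative \<mu> t * (l * M + M + \<alpha> - Y t)) (at t)"
      unfolding \<mu>_def Y_def by (auto intro!: derivative_eq_intros)
    have dE: "(E has_real_derivative
        (- l * (M * C t - (M + \<alpha> - X t) * A t)) * C' t + (1 * (M * C' t - (M + \<alpha>) * A' t)) * A t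
        + ((- l * (M * C t - (M + \<alpha>) * A t)) * A' t + (1 * (M * C' t - (M + \<alpha> - Y t) * A' t)) * C t)) (at t)"
      unfolding E_def by (rule DERIV_add[OF DERIV_mult[OF d(2,3)] DERIV_mult[OF d(1,4)]])
    show ?thesis
      by (rule DERIV_cong[OF DERIV_mult[OF d\<mu> dE]]) (simp only: S_def E_def, algebra)
  qed
  obtain t where t: "0 < t" "t < T" "\<mu> T * E T - \<mu> 0 * E 0 = (T - 0) * (\<mu> t * S t)"
    using MVT2[OF T, of "\<lambda>t. \<mu> t * E t" "\<lambda>t. \<mu> t * S t"] deriv by blast
  have "E 0 = 0" "E T = 0"
    using zeros by (simp_all add: E_def A_def A'_def C_def C'_def X0 Y0 XT YT)
  hence "S t = 0" using t(3) T by (simp add: \<mu>_def)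
  have X: "x < X t" "X t < a"
  proof -
    have "l * t < l * T" using t l(1) by simp
    hence "exp (- l * T) < exp (- l * t)" by simp
    hence "X T < X t" using order by (simp add: X_def)
    thus "x < X t" by (simp add: XT)
    show "X t < a" using order t l(1) by (simp add: X_def)
  qed
  have Y: "b < Y t" "Y t < y"
  proof -
    show "b < Y t" using order t by (simp add: Y_def)
    have "Y t < Y T" using order t by (simp add: Y_def)
    thus "Y t < y" by (simp add: YT)
  qed
  have sum: "X t + Y t < 4 * M + 2 * \<alpha>"
  proof -
    have "T * X t \<le> (T - t) * X 0 + t * X T"
      using mult_left_mono[OF exp_le_chord[of t T "- l"], of a] t order by (simp add: X_def algebra_simps)
    moreover have "T * Y t \<le> (T - t) * Y 0 + t * Y T"
      using mult_left_mono[OF exp_le_chord[of t T 1], of b] t order by (simp add: Y_def algebra_simps)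
    ultimately have "T * (X t + Y t) \<le> (T - t) * (a + b) + t * (x + y)"
      by (simp add: X0 Y0 XT YT algebra_simps)
    also have "\<dots> < (T - t) * (4 * M + 2 * \<alpha>) + t * (4 * M + 2 * \<alpha>)"
      using t sums[folded M_def]
      by (intro add_strict_mono[OF mult_strict_left_mono mult_strict_left_mono]) simp_all
    also have "\<dots> = T * (4 * M + 2 * \<alpha>)" by algebra
    finally show ?thesis using T by simp
  qed
  \<comment> \<open>The left position stays below the centre \<open>2 M + \<alpha>\<close>, so the factor \<open>l \<ge> 1\<close> only helps.\<close>
  have "2 * M + \<alpha> - X t > 0"
    using X(2) order(3) sums(1) unfolding M_def by linarith
  hence "1 * (2 * M + \<alpha> - X t) \<le> l * (2 * M + \<alpha> - X t)"
    using l(1) by (intro mult_right_mono) auto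
  moreover have "0 < 1 * (2 * M + \<alpha> - X t) + (2 * M + \<alpha> - Y t)"
    using sum by (simp add: algebra_simps)
  ultimately have bracket: "0 < l * (2 * M + \<alpha> - X t) + (2 * M + \<alpha> - Y t)"
    by (meson add_right_mono less_le_trans)
  have AC: "A t * C t < 0" using neg[OF X] by (simp add: A_def C_def)
  have AC': "A' t * C' t > 0" using pos[OF Y] by (simp add: A'_def C'_def)
  have "M + \<alpha> > 0" "M > 0" using \<alpha> by (simp_all add: M_def)
  \<comment> \<open>Multiplying by \<open>A t * C' t\<close> turns the common sign of the summands of \<open>S t\<close> into positivity.\<close>
  have "A t * C' t * S t = (l - 1) * ((M + \<alpha>) * ((A t)\<^sup>2 * (A' t * C' t)) + M * ((C' t)\<^sup>2 * - (A t * C t)))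
          + (A t * C' t)\<^sup>2 * (l * (2 * M + \<alpha> - X t) + (2 * M + \<alpha> - Y t))"
    unfolding S_def by algebra
  also have "\<dots> > 0"
  proof (rule add_nonneg_pos)
    have "0 \<le> (A t)\<^sup>2 * (A' t * C' t)" "0 \<le> (C' t)\<^sup>2 * - (A t * C t)"
      using AC AC' by (intro mult_nonneg_nonneg[OF zero_le_power2]; simp)+
    thus "0 \<le> (l - 1) * ((M + \<alpha>) * ((A t)\<^sup>2 * (A' t * C' t)) + M * ((C' t)\<^sup>2 * - (A t * C t)))"
      using l(1) less_imp_le[OF \<open>M + \<alpha> > 0\<close>] less_imp_le[OF \<open>M > 0\<close>]
      by (metis add_nonneg_nonneg diff_ge_0_iff_ge mult_nonneg_nonneg)
    have "A t * C' t \<noteq> 0" using AC AC' by auto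
    thus "0 < (A t * C' t)\<^sup>2 * (l * (2 * M + \<alpha> - X t) + (2 * M + \<alpha> - Y t))"
      using bracket by simp
  qed
  finally show False using \<open>S t = 0\<close> by simp
qed

text \<open>
  Interlacing provides the signs: with \<open>k\<close> zeros to the left of \<open>u\<close> the sign at \<open>u\<close> is
  \<open>(-1) ^ k\<close>. Between \<open>x\<close> and \<open>a\<close> the two polynomials have \<open>j\<close> and \<open>j - 1\<close> zeros to the left, between
  \<open>b\<close> and \<open>y\<close> they have equally many.
\<close>
lemma laguerre_zero_product_less:
  assumes \<alpha>: "\<alpha> > -1" and j: "1 \<le> j" "2 * j \<le> Suc n"
  shows "laguerre_zero \<alpha> n j * laguerre_zero \<alpha> n (Suc n - j)
           < laguerre_zero \<alpha> (Suc n) j * laguerre_zero \<alpha> (Suc n) (Suc (Suc n) - j)"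
proof (rule zero_product_less[OF \<alpha>])
  let ?z = "laguerre_zero \<alpha> n" and ?z' = "laguerre_zero \<alpha> (Suc n)"
  note zs = laguerre_zero_sequence_laguerre_zero[OF \<alpha>]
  have mono: "strict_mono_on {1..m} (laguerre_zero \<alpha> m)" for m
    using zs[of m] by (simp add: laguerre_zero_sequence_def)
  have k: "Suc n - j \<in> {1..n}" using j by (simp, linarith)
  have S: "Suc (Suc n) - j = Suc (Suc n - j)" using j by auto
  show "0 < ?z' j" using zs[of "Suc n"] j by (simp add: laguerre_zero_sequence_def)
  show "?z' j < ?z j" using j by (intro laguerre_zeros_interlace[OF \<alpha>]) auto
  show "?z j \<le> ?z (Suc n - j)" using j by (intro strict_mono_on_leD[OF mono]) auto
  show "?z (Suc n - j) < ?z' (Suc (Suc n) - j)"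
    unfolding S using j by (intro laguerre_zeros_interlace[OF \<alpha>]) auto
  show "poly (laguerre \<alpha> n) (?z j) = 0" "poly (laguerre \<alpha> n) (?z (Suc n - j)) = 0"
       "poly (laguerre \<alpha> (Suc n)) (?z' j) = 0" "poly (laguerre \<alpha> (Suc n)) (?z' (Suc (Suc n) - j)) = 0"
    unfolding poly_laguerre_eq_0_iff[OF zs] by (rule imageI, use j in \<open>simp; linarith\<close>)+
  show "poly (laguerre \<alpha> n) u * poly (laguerre \<alpha> (Suc n)) u < 0" if u: "?z' j < u" "u < ?z j" for u
  proof -
    have "(-1) ^ (j - 1) * poly (laguerre \<alpha> n) u > 0"
    proof (rule sign_laguerre_between_zeros[OF zs])
      show "?z (j - 1) < u" if "1 \<le> j - 1"
      proof -
        have "?z (j - 1) < ?z' (Suc (j - 1))"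
          using that j by (intro laguerre_zeros_interlace(2)[OF \<alpha>]) auto
        thus ?thesis using j u by simp
      qed
    qed (use j u in auto)
    moreover have "(-1) ^ Suc (j - 1) * poly (laguerre \<alpha> (Suc n)) u > 0"
    proof (rule sign_laguerre_between_zeros[OF zs])
      show "u < ?z' (Suc (Suc (j - 1)))"
        using laguerre_zeros_interlace(2)[OF \<alpha>, of j n] j u by auto
    qed (use j u in auto)
    ultimately have "0 < ((-1) ^ (j - 1) * poly (laguerre \<alpha> n) u) * ((-1) ^ Suc (j - 1) * poly (laguerre \<alpha> (Suc n)) u)"
      by (rule mult_pos_pos)
    also have "\<dots> = - (((-1) * (-1)) ^ (j - 1) * (poly (laguerre \<alpha> n) u * poly (laguerre \<alpha> (Suc n)) u))"
      unfolding power_mult_distrib by simp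
    finally show ?thesis by simp
  qed
  show "poly (laguerre \<alpha> n) u * poly (laguerre \<alpha> (Suc n)) u > 0"
    if u: "?z (Suc n - j) < u" "u < ?z' (Suc (Suc n) - j)" for u
  proof -
    have "(-1) ^ (Suc n - j) * poly (laguerre \<alpha> n) u > 0"
    proof (rule sign_laguerre_between_zeros[OF zs])
      show "u < ?z (Suc (Suc n - j))" if "Suc n - j < n"
        using laguerre_zeros_interlace(1)[OF \<alpha>, of "Suc (Suc n - j)" n] that j u unfolding S by auto
    qed (use j u in auto)
    moreover have "(-1) ^ (Suc n - j) * poly (laguerre \<alpha> (Suc n)) u > 0"
    proof (rule sign_laguerre_between_zeros[OF zs])
      show "?z' (Suc n - j) < u"
        using laguerre_zeros_interlace(1)[OF \<alpha> k] u by simp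
    qed (use j u S in auto)
    ultimately show ?thesis by (cases "even (Suc n - j)") (auto simp: mult_less_0_iff zero_less_mult_iff)
  qed
  show "?z j + ?z (Suc n - j) < 4 * real (Suc n) + 2 * \<alpha>"
    using laguerre_zero_sum_less[OF \<alpha>, of j n] j by simp
  show "?z' j + ?z' (Suc (Suc n) - j) < 4 * real (Suc n) + 2 * \<alpha>"
    using laguerre_zero_sum_less[OF \<alpha>, of j "Suc n"] j by simp
qed

theorem theorem1p1:
  fixes \<alpha> :: real
  assumes "\<alpha> > -1"
  shows "(\<forall>m j :: nat. 2 \<le> m \<longrightarrow> 1 \<le> j \<longrightarrow> j \<le> m div 2 \<longrightarrow>
           laguerre_zero \<alpha> (m - 1) j * laguerre_zero \<alpha> (m - 1) (m - j)
             < laguerre_zero \<alpha> m j * laguerre_zero \<alpha> m (m + 1 - j)) \<and>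
         (\<forall>j :: nat. 1 \<le> j \<longrightarrow>
           strict_mono_on {2 * j - 1..}
             (\<lambda>m. laguerre_zero \<alpha> m j * laguerre_zero \<alpha> m (m + 1 - j)))"
proof (intro conjI allI impI)
  fix m j :: nat
  assume "2 \<le> m" "1 \<le> j" "j \<le> m div 2"
  thus "laguerre_zero \<alpha> (m - 1) j * laguerre_zero \<alpha> (m - 1) (m - j)
          < laguerre_zero \<alpha> m j * laguerre_zero \<alpha> m (m + 1 - j)"
    using laguerre_zero_product_less[OF assms, of j "m - 1"] by (simp add: mult.commute[of 2])
next
  fix j :: nat
  assume j: "1 \<le> j"
  let ?f = "\<lambda>m. laguerre_zero \<alpha> m j * laguerre_zero \<alpha> m (m + 1 - j)"
  show "strict_mono_on {2 * j - 1..} ?f"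
  proof (rule strict_mono_onI)
    fix r s :: nat
    assume "r \<in> {2 * j - 1..}" "r < s"
    hence r: "2 * j - 1 \<le> r" by simp
    from \<open>r < s\<close> show "?f r < ?f s"
    proof (induction s)
      case (Suc s)
      have "?f s < ?f (Suc s)"
        using laguerre_zero_product_less[OF assms, of j s] j r Suc.prems by simp
      thus ?case using Suc by (cases "r = s") auto
    qed simp
  qed
qed

end
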